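(* Let $\kappa$ be any ordinal of cardinality $\mathfrak{c}$. Then: (i) For every non-minimal prime $z$-filter $\mathcal{P}$ on $\mathbb{R}$ there exists a well-ordered decreasing chain of order type $\kappa$ of prime $z$-filters on $\mathbb{R}$ starting from $\mathcal{P}$. (ii) For every non-minimal prime $z$-ideal $P$ in $C_0(\mathbb{R})$ there exists a well-ordered decreasing chain of order type $\kappa$ of prime $z$-ideals in $C_0(\mathbb{R})$ starting from $P$.
   Context: $\mathfrak{c}=2^{\aleph_0}$. A well-ordered decreasing chain of order type $\kappa$ is a family $(\mathcal{Q}_\alpha:\alpha\in\kappa)$ with $\mathcal{Q}_\beta\subsetneq\mathcal{Q}_\alpha$ whenever $\alpha<\beta$ in $\kappa$; it starts from $\mathcal{P}$ if its first member $\mathcal{Q}_0$ is $\mathcal{P}$. $C(\mathbb{R})$ is the algebra of continuous scalar-valued functions on $\mathbb{R}$ and $C_0(\mathbb{R})$ the subalgebra of those vanishing at infinity (scalar field real or complex, fixed). $\mathbf{Z}(f)=f^{-1}(0)$ and $\mathbf{Z}[\mathbb{R}]=\{\mathbf{Z}(f):f\in C(\mathbb{R})\}$. A $z$-filter on $\mathbb{R}$ is a non-empty proper subset of $\mathbf{Z}[\mathbb{R}]$ closed under finite intersections and under supersets belonging to $\mathbf{Z}[\mathbb{R}]$. A $z$-filter $\mathcal{P}$ is prime if $Z_1\cup Z_2\notin\mathcal{P}$ whenever $Z_1,Z_2\in\mathbf{Z}[\mathbb{R}]\setminus\mathcal{P}$. An ideal $I$ of $C_0(\mathbb{R})$ is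 a $z$-ideal if $g\in I$ whenever $g\in C_0(\mathbb{R})$, $f\in I$ and $\mathbf{Z}(g)\supset\mathbf{Z}(f)$. Prime ideals are proper. Non-minimal means not minimal under inclusion among prime $z$-filters on $\mathbb{R}$ (respectively prime $z$-ideals in $C_0(\mathbb{R})$). *)

theory Defs
  imports "HOL-Analysis.Analysis" "HOL-Library.Equipollence"
begin

text \<open>The scalar type \<open>'a\<close> below is meant to be \<open>real\<close> or \<open>complex\<close>.\<close>

definition CR :: "(real \<Rightarrow> 'a::real_normed_field) set" where
  "CR = {f. continuous_on UNIV f}"

definition C0R :: "(real \<Rightarrow> 'a::real_normed_field) set" where
  "C0R = {f \<in> CR. (f \<longlongrightarrow> 0) at_infinity}"

definition zero_set :: "(real \<Rightarrow> 'a::real_normed_field) \<Rightarrow> real set" where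
  "zero_set f = f -` {0}"

definition zero_sets :: "'a::real_normed_field itself \<Rightarrow> real set set" where
  "zero_sets _ = zero_set ` (CR :: (real \<Rightarrow> 'a) set)"

definition z_filter :: "'a::real_normed_field itself \<Rightarrow> real set set \<Rightarrow> bool" where
  "z_filter T F \<longleftrightarrow>
     F \<noteq> {} \<and> F \<subset> zero_sets T \<and>
     (\<forall>A\<in>F. \<forall>B\<in>F. A \<inter> B \<in> F) \<and>
     (\<forall>A\<in>F. \<forall>B\<in>zero_sets T. A \<subseteq> B \<longrightarrow> B \<in> F)"

definition prime_z_filter :: "'a::real_normed_field itself \<Rightarrow> real set set \<Rightarrow> bool" where
  "prime_z_filter T F \<longleftrightarrow>
     z_filter T F \<and>
     (\<forall>A \<in> zero_sets T - F. \<forall>B \<in> zero_sets T - F. A \<union> B \<notin> F)"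

text \<open>
  The ideals of \<open>HOL-Algebra\<close> live in unital rings, whereas \<open>C0R\<close> has no unit. Ideals are
  algebra ideals, so closure under scalar multiplication is a separate condition.
\<close>

definition C0R_ideal :: "(real \<Rightarrow> 'a::real_normed_field) set \<Rightarrow> bool" where
  "C0R_ideal I \<longleftrightarrow>
     I \<subseteq> C0R \<and> (\<lambda>x. 0) \<in> I \<and>
     (\<forall>f\<in>I. \<forall>g\<in>I. (\<lambda>x. f x + g x) \<in> I) \<and>
     (\<forall>c. \<forall>f\<in>I. (\<lambda>x. c * f x) \<in> I) \<and>
     (\<forall>f\<in>I. \<forall>h\<in>C0R. (\<lambda>x. h x * f x) \<in> I)"

definition C0R_prime_ideal :: "(real \<Rightarrow> 'a::real_normed_field) set \<Rightarrow> bool" where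
  "C0R_prime_ideal I \<longleftrightarrow>
     C0R_ideal I \<and> I \<noteq> C0R \<and>
     (\<forall>f\<in>C0R. \<forall>g\<in>C0R. (\<lambda>x. f x * g x) \<in> I \<longrightarrow> f \<in> I \<or> g \<in> I)"

definition C0R_z_ideal :: "(real \<Rightarrow> 'a::real_normed_field) set \<Rightarrow> bool" where
  "C0R_z_ideal I \<longleftrightarrow>
     C0R_ideal I \<and>
     (\<forall>g\<in>C0R. \<forall>f\<in>I. zero_set f \<subseteq> zero_set g \<longrightarrow> g \<in> I)"

definition prime_z_ideal :: "(real \<Rightarrow> 'a::real_normed_field) set \<Rightarrow> bool" where
  "prime_z_ideal I \<longleftrightarrow> C0R_prime_ideal I \<and> C0R_z_ideal I"

definition non_minimal :: "('b set \<Rightarrow> bool) \<Rightarrow> 'b set \<Rightarrow> bool" where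
  "non_minimal \<Phi> P \<longleftrightarrow> \<Phi> P \<and> (\<exists>Q. \<Phi> Q \<and> Q \<subset> P)"

text \<open>
  Ordinals are represented by well-orders in the sense of \<open>Well_order\<close>: \<open>r\<close> is a
  reflexive well-order on \<open>Field r\<close>, and the index \<open>0\<close> is its least element.
\<close>

definition decreasing_chain_from ::
  "'k rel \<Rightarrow> ('b set \<Rightarrow> bool) \<Rightarrow> 'b set \<Rightarrow> ('k \<Rightarrow> 'b set) \<Rightarrow> bool" where
  "decreasing_chain_from r \<Phi> P Q \<longleftrightarrow>
     (\<forall>\<alpha> \<in> Field r. \<Phi> (Q \<alpha>)) \<and>
     (\<forall>\<alpha> \<beta>. (\<alpha>, \<beta>) \<in> r \<and> \<alpha> \<noteq> \<beta> \<longrightarrow> Q \<beta> \<subset> Q \<alpha>) \<and>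
     Q (wo_rel.minim r (Field r)) = P"

end

theory Submission
  imports Defs
begin

text \<open>
  Every closed set is a zero set, so prime \<open>z\<close>-filters are the prime filters of closed sets, and these
  correspond to the prime \<open>z\<close>-ideals of \<open>C0R\<close> through the zero sets of their members.

  A non-minimal prime filter \<open>P\<close> contains a nowhere dense closed set \<open>N\<close>. Points \<open>x r\<close> outside \<open>N\<close> that
  accumulate everywhere on \<open>N\<close>, together with an ultrafilter \<open>U\<close> on the indices \<open>r\<close> along which \<open>x r\<close>
  avoids every closed set not in \<open>P\<close>, give prime filters below \<open>P\<close>: ultraproducts of prime filters
  of closed sets through the points \<open>x r\<close>. Taking for these first the point filters and iterating
  yields a decreasing sequence \<open>C y 0, C y 1, \<dots>\<close> of prime filters at every point \<open>y\<close>.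

  The chain consists of the ultraproducts of \<open>C (x r) (h \<alpha> r)\<close> for a family of functions \<open>h \<alpha>\<close> with
  \<open>h \<alpha> < h \<beta>\<close> \<open>U\<close>-almost everywhere whenever \<open>\<alpha> < \<beta>\<close>. Such a family exists for every well-order of
  size at most continuum because there are continuum many independent functions from a countable set
  to \<open>nat\<close>: any finitely many of them attain any prescribed values simultaneously.
\<close>

section \<open>Ultrafilters, in the order where finer filters are smaller\<close>

definition ultrafilter :: "'a filter \<Rightarrow> bool" where
  "ultrafilter U \<longleftrightarrow> U \<noteq> bot \<and> (\<forall>P. eventually P U \<or> eventually (\<lambda>x. \<not> P x) U)"

text \<open>Zorn's lemma yields a minimal proper filter \<open>U\<close> below \<open>F\<close>. It
  decides every \<open>P\<close>: adding \<open>P\<close> to \<open>U\<close> either gives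
  \<open>bot\<close>, so that the negation of \<open>P\<close> holds eventually, or changes nothing
  by minimality.\<close>

lemma ultrafilter_refines:
  fixes F :: "'a filter"
  assumes "F \<noteq> bot"
  obtains U where "ultrafilter U" "U \<le> F"
proof -
  let ?A = "{G. G \<noteq> bot \<and> G \<le> F}"
  have "\<exists>M\<in>?A. \<forall>G\<in>?A. M \<ge> G \<longrightarrow> G = M"
  proof (rule predicate_Zorn)
    show "partial_order_on ?A (relation_of (\<ge>) ?A)"
      by (rule partial_order_on_relation_ofI) auto
  next
    fix C assume C: "C \<in> Chains (relation_of (\<ge>) ?A)"
    then have CA: "C \<subseteq> ?A" and lin: "\<And>a b. a \<in> C \<Longrightarrow> b \<in> C \<Longrightarrow> a \<le> b \<or> b \<le> a"
      by (auto simp: Chains_def relation_of_def)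
    show "\<exists>u\<in>?A. \<forall>a\<in>C. a \<ge> u"
    proof (cases "C = {}")
      case True
      then show ?thesis using assms by auto
    next
      case False
      have "Inf C \<noteq> bot"
      proof (rule Inf_filter_not_bot)
        fix X assume X: "X \<subseteq> C" "finite X"
        have "Inf X \<noteq> bot" if "X \<noteq> {}"
        proof -
          have "Inf X \<in> X"
            using X(2) that X(1)
          proof (induction X rule: finite_ne_induct)
            case (insert a X)
            then have "a \<le> Inf X \<or> Inf X \<le> a"
              using lin by (metis insert_subset subset_eq)
            then show ?case
              using insert by (auto simp: inf_absorb1 inf_absorb2)
          qed simp
          then show ?thesis using X CA by auto
        qed
        moreover have "(top :: 'a filter) \<noteq> bot"
          using assms by (metis bot.extremum_uniqueI top_greatest)
        ultimately show "Inf X \<noteq> bot"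
          by (cases "X = {}") simp_all
      qed
      moreover have "Inf C \<le> F"
        using False CA by (metis (no_types, lifting) Inf_lower2 ex_in_conv mem_Collect_eq subsetD)
      ultimately show ?thesis
        by (auto intro!: bexI[of _ "Inf C"] Inf_lower)
    qed
  qed
  then obtain U where U: "U \<noteq> bot" "U \<le> F" and max: "\<And>G. G \<noteq> bot \<Longrightarrow> G \<le> F \<Longrightarrow> G \<le> U \<Longrightarrow> G = U"
    by auto
  have "eventually P U \<or> eventually (\<lambda>x. \<not> P x) U" for P
  proof (cases "inf U (principal {x. P x}) = bot")
    case True
    then show ?thesis
      by (simp add: trivial_limit_def eventually_inf_principal)
  next
    case False
    then have "inf U (principal {x. P x}) = U"
      using U by (intro max) (auto intro: le_infI1)
    then have "U \<le> principal {x. P x}"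
      by (metis inf_le2)
    then show ?thesis
      by (simp add: le_principal)
  qed
  then show ?thesis
    using that U unfolding ultrafilter_def by blast
qed

lemma ultrafilter_eventually_not:
  assumes "ultrafilter U"
  shows "eventually (\<lambda>x. \<not> P x) U \<longleftrightarrow> \<not> eventually P U"
proof
  assume "eventually (\<lambda>x. \<not> P x) U"
  then show "\<not> eventually P U"
    using assms eventually_conj[of P U "\<lambda>x. \<not> P x"]
    by (auto simp: ultrafilter_def trivial_limit_def)
qed (use assms in \<open>auto simp: ultrafilter_def\<close>)

lemma ultrafilter_eventually_disj:
  assumes "ultrafilter U" "eventually (\<lambda>x. P x \<or> Q x) U"
  shows "eventually P U \<or> eventually Q U"
proof (cases "eventually P U")
  case False
  then have "eventually (\<lambda>x. \<not> P x) U"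
    using ultrafilter_eventually_not[OF assms(1)] by blast
  with assms(2) have "eventually Q U"
    by eventually_elim auto
  then show ?thesis ..
qed simp

section \<open>Prime filters of closed sets and their ultraproducts\<close>

definition prime_closed_filter :: "'x::topological_space set set \<Rightarrow> bool" where
  "prime_closed_filter F \<longleftrightarrow>
     F \<subseteq> Collect closed \<and> UNIV \<in> F \<and> {} \<notin> F \<and>
     (\<forall>A\<in>F. \<forall>B\<in>F. A \<inter> B \<in> F) \<and>
     (\<forall>A\<in>F. \<forall>B. closed B \<longrightarrow> A \<subseteq> B \<longrightarrow> B \<in> F) \<and>
     (\<forall>A B. closed A \<longrightarrow> closed B \<longrightarrow> A \<union> B \<in> F \<longrightarrow> A \<in> F \<or> B \<in> F)"

lemma prime_closed_filterD:
  assumes "prime_closed_filter F"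
  shows "A \<in> F \<Longrightarrow> closed A" "UNIV \<in> F" "{} \<notin> F"
    "A \<in> F \<Longrightarrow> B \<in> F \<Longrightarrow> A \<inter> B \<in> F"
    "A \<in> F \<Longrightarrow> closed B \<Longrightarrow> A \<subseteq> B \<Longrightarrow> B \<in> F"
    "A \<union> B \<in> F \<Longrightarrow> closed A \<Longrightarrow> closed B \<Longrightarrow> A \<in> F \<or> B \<in> F"
  using assms unfolding prime_closed_filter_def by auto

text \<open>Primeness is where \<open>U\<close> has to be an ultrafilter: the indices with
  \<open>A \<union> B\<close> in \<open>F i\<close> are covered by those with \<open>A\<close> in
  \<open>F i\<close> and those with \<open>B\<close> in \<open>F i\<close>, and one of these two
  sets is \<open>U\<close>-large.\<close>

lemma prime_closed_filter_ultraproduct: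
  assumes U: "ultrafilter U" and F: "\<And>i. prime_closed_filter (F i)"
  shows "prime_closed_filter {A. closed A \<and> eventually (\<lambda>i. A \<in> F i) U}"
  unfolding prime_closed_filter_def
proof (intro conjI allI ballI impI)
  show "{} \<notin> {A. closed A \<and> (\<forall>\<^sub>F i in U. A \<in> F i)}"
    using U prime_closed_filterD(3)[OF F] by (auto simp: ultrafilter_def)
next
  fix A B assume "A \<in> {A. closed A \<and> (\<forall>\<^sub>F i in U. A \<in> F i)}" "B \<in> {A. closed A \<and> (\<forall>\<^sub>F i in U. A \<in> F i)}"
  then show "A \<inter> B \<in> {A. closed A \<and> (\<forall>\<^sub>F i in U. A \<in> F i)}"
    using eventually_conj[of "\<lambda>i. A \<in> F i" U "\<lambda>i. B \<in> F i"]
    by (auto elim!: eventually_mono intro: prime_closed_filterD(4)[OF F])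
next
  fix A B assume "A \<in> {A. closed A \<and> (\<forall>\<^sub>F i in U. A \<in> F i)}" "closed B" "A \<subseteq> B"
  then show "B \<in> {A. closed A \<and> (\<forall>\<^sub>F i in U. A \<in> F i)}"
    by (auto elim!: eventually_mono intro: prime_closed_filterD(5)[OF F])
next
  fix A B assume A: "closed A" "closed B" "A \<union> B \<in> {A. closed A \<and> (\<forall>\<^sub>F i in U. A \<in> F i)}"
  have "\<forall>\<^sub>F i in U. A \<in> F i \<or> B \<in> F i"
    using A by (auto elim!: eventually_mono dest: prime_closed_filterD(6)[OF F])
  then show "A \<in> {A. closed A \<and> (\<forall>\<^sub>F i in U. A \<in> F i)} \<or> B \<in> {A. closed A \<and> (\<forall>\<^sub>F i in U. A \<in> F i)}"
    using ultrafilter_eventually_disj[OF U] A by auto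
qed (use prime_closed_filterD(2)[OF F] in auto)

lemma prime_closed_filter_point:
  fixes x :: "'x::t1_space"
  shows "prime_closed_filter {A. closed A \<and> x \<in> A}"
  unfolding prime_closed_filter_def by auto

section \<open>Nowhere dense members and sequences converging fast to them\<close>

text \<open>The boundary of any \<open>A\<close> in \<open>P - Q\<close> will do: \<open>A\<close>
  and \<open>closure (- A)\<close> cover the space, so primeness of \<open>Q\<close> puts the latter
  into \<open>Q\<close> and hence into \<open>P\<close>.\<close>

lemma non_minimal_imp_nowhere_dense:
  assumes "non_minimal prime_closed_filter P"
  obtains N where "N \<in> P" "interior N = {}"
proof -
  obtain Q where P: "prime_closed_filter P" and Q: "prime_closed_filter Q" "Q \<subset> P"
    using assms by (auto simp: non_minimal_def)
  then obtain A where A: "A \<in> P" "A \<notin> Q" by auto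
  have "closed A" using P A by (simp add: prime_closed_filterD)
  have "A \<union> closure (- A) = UNIV" using closure_subset[of "- A"] by auto
  then have "closure (- A) \<in> Q"
    using prime_closed_filterD(2,6)[OF Q(1)] A \<open>closed A\<close> by (metis closed_closure)
  then have "A \<inter> closure (- A) \<in> P"
    using Q A prime_closed_filterD(4)[OF P] by blast
  moreover have "interior (A \<inter> closure (- A)) = {}"
    using interior_subset by (auto simp: closure_complement)
  ultimately show ?thesis using that by blast
qed

text \<open>The shells \<open>{y. infdist (x r) N / 2 \<le> infdist y N \<le> 2 * infdist (x r) N}\<close> around \<open>N\<close> are
  then disjoint, and they accumulate only at \<open>N\<close>.\<close>

definition converges_fast :: "'x::metric_space set \<Rightarrow> (nat \<Rightarrow> 'x) \<Rightarrow> bool" where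
  "converges_fast N x \<longleftrightarrow>
     (\<forall>r. x r \<notin> N) \<and> (\<forall>r. 9 * infdist (x (Suc r)) N \<le> infdist (x r) N)"

lemma converges_fast_less:
  assumes "converges_fast N x" "r < s"
  shows "9 * infdist (x s) N \<le> infdist (x r) N"
  using assms(2)
proof (induction s)
  case (Suc s)
  have "9 * infdist (x (Suc s)) N \<le> infdist (x s) N"
    using assms(1) by (simp add: converges_fast_def)
  moreover have "r = s \<or> 9 * infdist (x s) N \<le> infdist (x r) N"
    using Suc by (auto simp: less_Suc_eq)
  ultimately show ?case
    using infdist_nonneg[of "x s" N] infdist_nonneg[of "x r" N] by auto
qed simp

lemma converges_fast_finite:
  assumes "converges_fast N x" "c > 0"
  shows "finite {r. infdist (x r) N \<ge> c}"
proof -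
  have b: "infdist (x r) N \<le> infdist (x 0) N * (1/9) ^ r" for r
  proof (induction r)
    case (Suc r)
    have "9 * infdist (x (Suc r)) N \<le> infdist (x r) N"
      using assms(1) by (simp add: converges_fast_def)
    then show ?case using Suc by simp
  qed simp
  have "(\<lambda>r. infdist (x 0) N * (1/9) ^ r) \<longlonglongrightarrow> infdist (x 0) N * 0"
    by (intro tendsto_intros LIMSEQ_power_zero) simp
  then have "\<forall>\<^sub>F r in sequentially. infdist (x 0) N * (1/9) ^ r < c"
    using assms(2) by (intro order_tendstoD) auto
  then have "\<forall>\<^sub>F r in sequentially. \<not> infdist (x r) N \<ge> c"
    by eventually_elim (use b in \<open>smt (verit)\<close>)
  then show ?thesis
    by (simp add: cofinite_eq_sequentially[symmetric] eventually_cofinite)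
qed

text \<open>This turns choices made separately at each index into one closed set, which can then
  tell ultraproducts over \<open>r\<close> apart. \<open>Z\<close> consists of \<open>N\<close> and
  the part of each \<open>K r\<close> in the shell around \<open>x r\<close>. Near
  \<open>x r\<close> only \<open>K r\<close> is visible, and \<open>N\<close> catches the
  accumulation points of the shells.\<close>

lemma converges_fast_glue:
  fixes N :: "'x::metric_space set"
  assumes N: "closed N" "N \<noteq> {}" "interior N = {}"
    and x: "converges_fast N x"
    and K: "\<And>r. closed (K r)" "\<And>r. interior (K r) = {}"
  obtains Z where "closed Z" "interior Z = {}"
    "\<And>r F. prime_closed_filter F \<Longrightarrow> (\<And>A. A \<in> F \<Longrightarrow> x r \<in> A) \<Longrightarrow> Z \<in> F \<longleftrightarrow> K r \<in> F"
proof -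
  define g where "g y = infdist y N" for y
  have g_pos: "g y > 0" if "y \<notin> N" for y
    using N that unfolding g_def by (simp add: infdist_pos_not_in_closed)
  have g_N: "g y = 0" if "y \<in> N" for y
    using that by (simp add: g_def)
  have gx: "g (x r) > 0" for r
    using x g_pos by (auto simp: converges_fast_def)
  have less: "9 * g (x s) \<le> g (x r)" if "r < s" for r s
    using converges_fast_less[OF x that] by (simp add: g_def)
  have cont: "continuous_on A g" for A
    unfolding g_def by (intro continuous_intros)
  have closed_ge: "closed {y. a \<le> g y}" and closed_le: "closed {y. g y \<le> a}" for a
    by (intro closed_Collect_le cont continuous_on_const)+
  have open_gt: "open {y. a < g y}" and open_lt: "open {y. g y < a}" for a
    by (intro open_Collect_less cont continuous_on_const)+
  define S where "S r = {y. g (x r) / 2 \<le> g y} \<inter> {y. g y \<le> 2 * g (x r)}" for r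
  \<comment> \<open>\<open>W r\<close> is an open margin around \<open>S r\<close> that misses
    \<open>N\<close> and all other shells. The ratio 9 suffices because it exceeds 2 * 3.\<close>
  define W where "W r = {y. g (x r) / 3 < g y} \<inter> {y. g y < 3 * g (x r)}" for r
  have S: "closed (S r)" for r unfolding S_def by (intro closed_Int closed_ge closed_le)
  have W: "open (W r)" for r unfolding W_def by (intro open_Int open_gt open_lt)
  have SW: "S r \<subseteq> W r" for r using gx[of r] by (auto simp: S_def W_def)
  have SW_disj: "S s \<inter> W r = {}" if "s \<noteq> r" for r s
    using that less[of r s] less[of s r] gx[of r] gx[of s]
    by (cases s r rule: linorder_cases) (auto simp: S_def W_def)
  have NW: "N \<inter> W r = {}" for r
    using g_N gx[of r] by (fastforce simp: W_def)
  define Z where "Z = N \<union> (\<Union>r. K r \<inter> S r)"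
  have ZW: "Z \<inter> W r \<subseteq> K r" for r
  proof
    fix y assume y: "y \<in> Z \<inter> W r"
    then obtain s where s: "y \<in> K s" "y \<in> S s" using NW[of r] unfolding Z_def by auto
    then have "s = r" using SW_disj[of s r] y by auto
    then show "y \<in> K r" using s by simp
  qed
  have "closed Z"
    unfolding closed_def
  proof (subst open_subopen, intro ballI)
    fix y assume y: "y \<in> - Z"
    then have gy: "g y > 0" using g_pos by (auto simp: Z_def)
    \<comment> \<open>A point \<open>z\<close> of \<open>S r\<close> with
      \<open>g z > g y / 2\<close> has \<open>g (x r) > g y / 4\<close>, so only the finitely many
      shells with index in \<open>?R\<close> can come close to \<open>y\<close>.\<close>
    let ?R = "{r. g (x r) \<ge> g y / 4}"
    have "finite ?R"
      using converges_fast_finite[OF x, of "g y / 4"] gy by (simp add: g_def)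
    then have cl: "closed (\<Union>r\<in>?R. K r \<inter> S r)"
      by (intro closed_UN) (auto intro: K S)
    let ?T = "{z. g y / 2 < g z} \<inter> - (\<Union>r\<in>?R. K r \<inter> S r)"
    have "open ?T" using cl by (intro open_Int open_gt open_Compl)
    moreover have "y \<in> ?T" using y gy by (auto simp: Z_def)
    moreover have "?T \<subseteq> - Z"
    proof
      fix z assume z: "z \<in> ?T"
      show "z \<in> - Z"
      proof
        assume "z \<in> Z"
        moreover have "z \<notin> N" using z gy g_N by force
        ultimately obtain r where r: "z \<in> K r" "z \<in> S r" by (auto simp: Z_def)
        then have "r \<notin> ?R" using z by blast
        then show False using z r by (auto simp: S_def)
      qed
    qed
    ultimately show "\<exists>T. open T \<and> y \<in> T \<and> T \<subseteq> - Z" by blast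
  qed
  moreover have "interior Z = {}"
  proof (rule ccontr)
    assume "interior Z \<noteq> {}"
    \<comment> \<open>A nonempty open set does not fit into \<open>N\<close>, so
      \<open>interior Z\<close> would meet some \<open>S r\<close>; inside \<open>W r\<close> it
      would be an open part of \<open>K r\<close>.\<close>
    then have "\<not> interior Z \<subseteq> N"
      using N(3) interior_maximal[of "interior Z" N] by auto
    then obtain y where y: "y \<in> interior Z" "y \<notin> N" by auto
    then obtain r where r: "y \<in> S r" using interior_subset unfolding Z_def by blast
    have "interior Z \<inter> W r \<subseteq> interior (K r)"
      using ZW[of r] interior_subset[of Z] W by (intro interior_maximal) auto
    then show False using K(2)[of r] y r SW by auto
  qed
  moreover have "Z \<in> F \<longleftrightarrow> K r \<in> F"
    if F: "prime_closed_filter F" and xF: "\<And>A. A \<in> F \<Longrightarrow> x r \<in> A" for r F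
  proof -
    \<comment> \<open>The shell and the closed set \<open>?C\<close> cover the space, and
      \<open>x r\<close> is not in \<open>?C\<close>; primeness therefore puts the shell into every
      prime filter at \<open>x r\<close>.\<close>
    have cl: "closed ({y. g y \<le> g (x r) / 2} \<union> {y. 2 * g (x r) \<le> g y})" (is "closed ?C")
      by (intro closed_Un closed_ge closed_le)
    have "x r \<notin> ?C" using gx[of r] by auto
    moreover have "S r \<union> ?C = UNIV" unfolding S_def by (auto simp: not_le)
    ultimately have SF: "S r \<in> F"
      using prime_closed_filterD(2,6)[OF F] xF cl S by metis
    show ?thesis
    proof
      assume "Z \<in> F"
      then have "Z \<inter> S r \<in> F" using SF prime_closed_filterD(4)[OF F] by blast
      then show "K r \<in> F"
        using prime_closed_filterD(5)[OF F _ K(1)] ZW[of r] SW[of r] by blast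
    next
      assume "K r \<in> F"
      then have "K r \<inter> S r \<in> F" using SF prime_closed_filterD(4)[OF F] by blast
      then show "Z \<in> F"
        using prime_closed_filterD(5)[OF F _ \<open>closed Z\<close>] by (auto simp: Z_def)
    qed
  qed
  ultimately show ?thesis using that by blast
qed

lemma ex_point_near_nowhere_dense:
  fixes N :: "'x::metric_space set"
  assumes N: "closed N" "interior N = {}" and b: "open b" "b \<inter> N \<noteq> {}" and "c > 0"
  shows "\<exists>y\<in>b. y \<notin> N \<and> infdist y N < c"
proof -
  obtain z where z: "z \<in> b" "z \<in> N" using b by auto
  then have "\<not> b \<inter> ball z c \<subseteq> N"
    using interior_maximal[of "b \<inter> ball z c" N] N b \<open>c > 0\<close> by (metis Int_iff centre_in_ball empty_iff open_Int open_ball subsetD)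
  then obtain y where y: "y \<in> b" "dist z y < c" "y \<notin> N"
    by (metis Int_iff mem_ball subsetI)
  then have "infdist y N < c"
    using infdist_le[OF z(2), of y] by (simp add: dist_commute)
  then show ?thesis using y by auto
qed

text \<open>Enumerate all pairs of a basic open set meeting \<open>N\<close> and a label; the r-th
  point is chosen in the open set of the r-th pair, off \<open>N\<close> and close enough to
  \<open>N\<close> for the ratio 9. Since every label recurs near every point of \<open>N\<close>, a
  filter on labels can later be imposed on the indices.\<close>

lemma ex_labelled_converges_fast:
  fixes N :: "'x::{metric_space,second_countable_topology} set"
  assumes N: "closed N" "N \<noteq> {}" "interior N = {}"
  obtains x :: "nat \<Rightarrow> 'x" and lab :: "nat \<Rightarrow> 'e::countable"
  where "converges_fast N x"
    "\<And>e b. open b \<Longrightarrow> b \<inter> N \<noteq> {} \<Longrightarrow> \<exists>r. lab r = e \<and> x r \<in> b"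
proof -
  obtain B :: "'x set set" where B: "countable B" "topological_basis B"
    using ex_countable_basis by blast
  define T where "T = {b \<in> B. b \<inter> N \<noteq> {}} \<times> (UNIV :: 'e set)"
  have meets: "\<exists>c\<in>B. c \<inter> N \<noteq> {} \<and> c \<subseteq> b" if "open b" "b \<inter> N \<noteq> {}" for b
    using that B(2) by (metis disjoint_iff topological_basisE)
  have "countable T" using B by (auto simp: T_def)
  moreover have "T \<noteq> {}" using meets[of UNIV] N(2) by (auto simp: T_def)
  ultimately have rT: "range (from_nat_into T) = T"
    by simp
  define q where "q = from_nat_into T"
  have q: "range q = T"
    using rT by (simp add: q_def)
  have qT: "open (fst (q r))" "fst (q r) \<inter> N \<noteq> {}" for r
  proof -
    have "q r \<in> T" using q by blast
    then show "open (fst (q r))" "fst (q r) \<inter> N \<noteq> {}"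
      using topological_basis_open[OF B(2)] by (auto simp: T_def)
  qed
  have "\<exists>x. \<forall>r. (x r \<in> fst (q r) \<and> x r \<notin> N) \<and> 9 * infdist (x (Suc r)) N \<le> infdist (x r) N"
  proof (rule dependent_nat_choice)
    show "\<exists>y. y \<in> fst (q 0) \<and> y \<notin> N"
      using ex_point_near_nowhere_dense[OF N(1,3) qT, of 1] by auto
  next
    fix y r assume "y \<in> fst (q r) \<and> y \<notin> N"
    then have "infdist y N / 9 > 0"
      using N by (simp add: infdist_pos_not_in_closed)
    from ex_point_near_nowhere_dense[OF N(1,3) qT this, of "Suc r"]
    show "\<exists>z. (z \<in> fst (q (Suc r)) \<and> z \<notin> N) \<and> 9 * infdist z N \<le> infdist y N"
      by auto
  qed
  then obtain x where x: "\<And>r. x r \<in> fst (q r)" "\<And>r. x r \<notin> N"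
      "\<And>r. 9 * infdist (x (Suc r)) N \<le> infdist (x r) N"
    by blast
  show ?thesis
  proof
    show "converges_fast N x" using x by (simp add: converges_fast_def)
    fix e :: 'e and b :: "'x set" assume "open b" "b \<inter> N \<noteq> {}"
    then obtain c where c: "c \<in> B" "c \<inter> N \<noteq> {}" "c \<subseteq> b" using meets by blast
    then have "(c, e) \<in> range q" by (simp add: q T_def)
    then obtain r where "q r = (c, e)" by auto
    then show "\<exists>r. (snd \<circ> q) r = e \<and> x r \<in> b"
      using x(1)[of r] c by (intro exI[of _ r]) auto
  qed
qed

section \<open>Prime filters below a given one\<close>

text \<open>The last clause forces ultraproducts of filters at the points \<open>x r\<close> to lie
  below \<open>P\<close>; the clause on \<open>lab\<close> transports \<open>G\<close> from labels
  to indices. The two are compatible: a closed \<open>A\<close> outside \<open>P\<close> does not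
  contain \<open>N\<close>, so the open set \<open>- A\<close> meets \<open>N\<close> and holds
  points \<open>x r\<close> of every label.\<close>

lemma ex_ultrafilter_below:
  fixes P :: "'x::{metric_space,second_countable_topology} set set" and G :: "'e::countable filter"
  assumes P: "prime_closed_filter P" and N: "N \<in> P" "interior N = {}" and G: "G \<noteq> bot"
  obtains x :: "nat \<Rightarrow> 'x" and lab :: "nat \<Rightarrow> 'e" and U where
    "converges_fast N x" "ultrafilter U" "filterlim lab G U"
    "\<And>A. closed A \<Longrightarrow> A \<notin> P \<Longrightarrow> \<forall>\<^sub>F r in U. x r \<notin> A"
proof -
  have clN: "closed N" using P N by (simp add: prime_closed_filterD)
  moreover have "N \<noteq> {}" using P N prime_closed_filterD(3) by blast
  ultimately obtain x :: "nat \<Rightarrow> 'x" and lab :: "nat \<Rightarrow> 'e" where x: "converges_fast N x"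
    and near: "\<And>e b. open b \<Longrightarrow> b \<inter> N \<noteq> {} \<Longrightarrow> \<exists>r. lab r = e \<and> x r \<in> b"
    using ex_labelled_converges_fast[OF _ _ N(2)] by metis
  define I where "I = {A. closed A \<and> A \<notin> P}"
  define H where "H = (INF A\<in>I. principal {r. x r \<notin> A})"
  have "{} \<in> I" using prime_closed_filterD(3)[OF P] by (simp add: I_def)
  \<comment> \<open>Primeness of \<open>P\<close> makes \<open>I\<close> directed, so the sets
    \<open>{r. x r \<notin> A}\<close> form a base of \<open>H\<close>.\<close>
  have Un: "A \<union> B \<in> I" if "A \<in> I" "B \<in> I" for A B
    using that prime_closed_filterD(6)[OF P] by (auto simp: I_def)
  have evH: "eventually Q H \<longleftrightarrow> (\<exists>A\<in>I. \<forall>r. x r \<notin> A \<longrightarrow> Q r)" for Q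
    unfolding H_def
  proof (subst eventually_INF_base)
    show "I \<noteq> {}" using \<open>{} \<in> I\<close> by blast
    show "\<exists>C\<in>I. principal {r. x r \<notin> C} \<le> inf (principal {r. x r \<notin> A}) (principal {r. x r \<notin> B})"
      if "A \<in> I" "B \<in> I" for A B
      using Un[OF that] by (intro bexI[of _ "A \<union> B"]) auto
  qed (simp add: eventually_principal)
  have "inf (filtercomap lab G) H \<noteq> bot"
  proof
    assume "inf (filtercomap lab G) H = bot"
    then obtain Q A where Q: "eventually Q G" and A: "A \<in> I" "\<And>r. Q (lab r) \<Longrightarrow> x r \<in> A"
      unfolding trivial_limit_def eventually_inf eventually_filtercomap evH by metis
    obtain e where "Q e" using Q G by (metis eventually_happens)
    have "\<not> N \<subseteq> A" using A N prime_closed_filterD(5)[OF P] by (auto simp: I_def)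
    then have "(- A) \<inter> N \<noteq> {}" by auto
    moreover have "open (- A)" using A by (auto simp: I_def)
    ultimately obtain r where "lab r = e" "x r \<in> - A" using near by blast
    then show False using A(2) \<open>Q e\<close> by auto
  qed
  then obtain U where U: "ultrafilter U" "U \<le> inf (filtercomap lab G) H"
    by (rule ultrafilter_refines)
  show ?thesis
  proof
    show "converges_fast N x" "ultrafilter U" by fact+
    show "filterlim lab G U"
      using U by (simp add: filterlim_iff_le_filtercomap)
    fix A assume "closed A" "A \<notin> P"
    then have "\<forall>\<^sub>F r in H. x r \<notin> A" unfolding evH by (auto simp: I_def)
    then show "\<forall>\<^sub>F r in U. x r \<notin> A" using U(2) filter_leD by auto
  qed
qed

text \<open>\<open>Q\<close> is an ultraproduct of the point filters at \<open>x r\<close>. It omits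
  \<open>N\<close> because no \<open>x r\<close> lies in \<open>N\<close>. The set \<open>M\<close>,
  glued from the singletons \<open>{x r}\<close>, which are nowhere dense in a perfect space, makes
  the step repeatable.\<close>

lemma ex_prime_closed_filter_below:
  fixes P :: "'x::{metric_space,perfect_space,second_countable_topology} set set"
  assumes P: "prime_closed_filter P" and N: "N \<in> P" "interior N = {}"
  obtains Q M where "prime_closed_filter Q" "Q \<subseteq> P" "N \<notin> Q" "M \<in> Q" "interior M = {}"
proof -
  obtain x and lab :: "nat \<Rightarrow> nat" and U where x: "converges_fast N x" and U: "ultrafilter U"
    and P': "\<And>A. closed A \<Longrightarrow> A \<notin> P \<Longrightarrow> \<forall>\<^sub>F r in U. x r \<notin> A"
    using ex_ultrafilter_below[OF P N, of sequentially] by (metis sequentially_bot)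
  define Q where "Q = {A. closed A \<and> (\<forall>\<^sub>F r in U. A \<in> {A. closed A \<and> x r \<in> A})}"
  have N': "closed N" "N \<noteq> {}" using P N prime_closed_filterD by blast+
  obtain M where M: "closed M" "interior M = {}"
    "\<And>r F. prime_closed_filter F \<Longrightarrow> (\<And>A. A \<in> F \<Longrightarrow> x r \<in> A) \<Longrightarrow> M \<in> F \<longleftrightarrow> {x r} \<in> F"
    using converges_fast_glue[OF N' N(2) x, of "\<lambda>r. {x r}"] by auto
  have "x r \<in> M" for r
    using M(3)[OF prime_closed_filter_point, of "x r"] by auto
  show ?thesis
  proof
    show "prime_closed_filter Q"
      unfolding Q_def by (intro prime_closed_filter_ultraproduct U prime_closed_filter_point)
    show "Q \<subseteq> P"
    proof
      fix A assume A: "A \<in> Q"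
      show "A \<in> P"
      proof (rule ccontr)
        assume "A \<notin> P"
        then have "\<forall>\<^sub>F r in U. x r \<notin> A" using A P' by (simp add: Q_def)
        then show False
          using A ultrafilter_eventually_not[OF U, of "\<lambda>r. x r \<in> A"]
          by (auto simp: Q_def elim!: eventually_mono)
      qed
    qed
    show "N \<notin> Q" using x U by (auto simp: Q_def converges_fast_def ultrafilter_def)
    show "M \<in> Q" using M(1) \<open>\<And>r. x r \<in> M\<close> by (simp add: Q_def)
    show "interior M = {}" by fact
  qed
qed

text \<open>The previous step is iterated from the point filter. \<open>K k\<close> is both the
  nowhere dense member from which the descent continues and the witness that
  \<open>C (Suc k)\<close> is smaller. Strictness is stated through such sets because they can be
  glued over the points \<open>x r\<close>.\<close>

lemma ex_prime_closed_filter_sequence: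
  fixes x :: "'x::{metric_space,perfect_space,second_countable_topology}"
  shows "\<exists>C K. (\<forall>k. prime_closed_filter (C k)) \<and> decseq C \<and> (\<forall>A\<in>C 0. x \<in> A) \<and>
    (\<forall>k. K k \<in> C k \<and> interior (K k) = {}) \<and> (\<forall>i j. i < j \<longrightarrow> K i \<notin> C j)"
proof -
  \<comment> \<open>The condition at \<open>x\<close> is carried only for \<open>k = 0\<close>;
    later terms inherit it by inclusion in the first.\<close>
  let ?R = "\<lambda>k p. prime_closed_filter (fst p) \<and> snd p \<in> fst p \<and> interior (snd p) = {} \<and>
    (k = (0::nat) \<longrightarrow> (\<forall>A\<in>fst p. x \<in> A))"
  let ?S = "\<lambda>p q. fst q \<subseteq> fst p \<and> snd p \<notin> fst q"
  have "\<exists>f. \<forall>k. ?R k (f k) \<and> ?S (f k) (f (Suc k))"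
  proof (rule dependent_nat_choice)
    show "\<exists>p. ?R 0 p"
      by (intro exI[of _ "({A. closed A \<and> x \<in> A}, {x})"]) (auto intro: prime_closed_filter_point)
  next
    fix p and k :: nat assume p: "?R k p"
    obtain Q M where "prime_closed_filter Q" "Q \<subseteq> fst p" "snd p \<notin> Q" "M \<in> Q" "interior M = {}"
      using p ex_prime_closed_filter_below[of "fst p" "snd p"] by metis
    then show "\<exists>q. ?R (Suc k) q \<and> ?S p q"
      by (intro exI[of _ "(Q, M)"]) auto
  qed
  then obtain f where f: "\<forall>k. ?R k (f k) \<and> ?S (f k) (f (Suc k))" ..
  define C K where "C k = fst (f k)" and "K k = snd (f k)" for k
  have CK: "prime_closed_filter (C k)" "K k \<in> C k" "interior (K k) = {}"
      "C (Suc k) \<subseteq> C k" "K k \<notin> C (Suc k)" "\<forall>A\<in>C 0. x \<in> A" for k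
    using spec[OF f, of k] spec[OF f, of 0] by (simp_all add: C_def K_def)
  have "decseq C" using CK(4) by (simp add: decseq_Suc_iff)
  moreover have "K i \<notin> C j" if "i < j" for i j
    using decseqD[OF \<open>decseq C\<close>, of "Suc i" j] that CK(5)[of i] by auto
  ultimately show ?thesis using CK by (intro exI[of _ C] exI[of _ K]) simp
qed

section \<open>Functions increasing modulo a filter\<close>

text \<open>An argument \<open>(n, l)\<close> is a finite table \<open>l\<close> of values for
  boolean words of length \<open>n\<close>, and \<open>F X\<close> looks up the word of
  \<open>X\<close> below \<open>n\<close>. Finitely many sets have different words once
  \<open>n\<close> is large, so their values can be tabulated at will. The arguments form a
  countable type and can thus serve as labels.\<close>

lemma ex_independent_functions:
  obtains F :: "nat set \<Rightarrow> nat \<times> (bool list \<times> nat) list \<Rightarrow> nat"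
  where "\<And>S h. finite S \<Longrightarrow> \<exists>e. \<forall>X\<in>S. F X e = h X"
proof
  let ?t = "\<lambda>n X. map (\<lambda>i. i \<in> X) [0..<n]"
  \<comment> \<open>A word without entry gets the unspecified value \<open>the None\<close>; the
    table \<open>l\<close> built below has an entry for every member of \<open>S\<close>.\<close>
  let ?F = "\<lambda>X e. the (map_of (snd e) (?t (fst e) X))"
  fix S :: "nat set set" and h :: "nat set \<Rightarrow> nat"
  assume S: "finite S"
  define w where "w p = (LEAST i. (i \<in> fst p) \<noteq> (i \<in> snd p))" for p :: "nat set \<times> nat set"
  have w: "(w (X, Y) \<in> X) \<noteq> (w (X, Y) \<in> Y)" if "X \<noteq> Y" for X Y
    using that LeastI_ex[of "\<lambda>i. (i \<in> X) \<noteq> (i \<in> Y)"] unfolding w_def fst_conv snd_conv by blast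
  have "finite (w ` (S \<times> S))" using S by simp
  then obtain n where n: "\<And>p. p \<in> S \<times> S \<Longrightarrow> w p < n"
    unfolding finite_nat_set_iff_bounded by blast
  have inj: "X = Y" if "X \<in> S" "Y \<in> S" "?t n X = ?t n Y" for X Y
  proof (rule ccontr)
    assume "X \<noteq> Y"
    then have "(w (X, Y) \<in> X) \<noteq> (w (X, Y) \<in> Y)" by (rule w)
    moreover have "w (X, Y) < n" using n that by simp
    ultimately show False using that(3) by simp
  qed
  obtain xs where xs: "set xs = S" using S finite_list by blast
  define l where "l = map (\<lambda>X. (?t n X, h X)) xs"
  have "?F X (n, l) = h X" if X: "X \<in> S" for X
  proof -
    have "(?t n X, h X) \<in> set l" using X xs by (auto simp: l_def)
    \<comment> \<open>\<open>map_of\<close> returns the first entry for the word; by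
      \<open>inj\<close> any entry for it comes from \<open>X\<close> itself.\<close>
    then obtain k where k: "map_of l (?t n X) = Some k"
      using weak_map_of_SomeI by fastforce
    then obtain Y where "Y \<in> S" "?t n X = ?t n Y" "k = h Y"
      using map_of_SomeD[OF k] xs by (auto simp: l_def)
    then show ?thesis using k inj[OF X] by simp
  qed
  then show "\<exists>e. \<forall>X\<in>S. ?F X e = h X" by blast
qed

text \<open>\<open>G\<close> is generated by the sets on which the required inequalities hold. It is
  proper: finitely many inequalities involve finitely many indices \<alpha>, and independence yields
  an \<open>e\<close> at which each \<open>f \<alpha>\<close> takes as value the rank of \<alpha>
  among them.\<close>

lemma ex_increasing_modulo_filter:
  fixes \<kappa> :: "'k rel"
  assumes \<kappa>: "Well_order \<kappa>" and card: "Field \<kappa> \<lesssim> (UNIV :: nat set set)"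
  obtains f :: "'k \<Rightarrow> nat \<times> (bool list \<times> nat) list \<Rightarrow> nat" and G where "G \<noteq> bot"
    "\<And>\<alpha> \<beta>. (\<alpha>, \<beta>) \<in> \<kappa> \<Longrightarrow> \<alpha> \<noteq> \<beta> \<Longrightarrow> \<forall>\<^sub>F e in G. f \<alpha> e < f \<beta> e"
proof -
  obtain \<phi> :: "'k \<Rightarrow> nat set" where \<phi>: "inj_on \<phi> (Field \<kappa>)"
    using card by (auto simp: lepoll_def)
  obtain F :: "nat set \<Rightarrow> nat \<times> (bool list \<times> nat) list \<Rightarrow> nat"
    where F: "\<And>S h. finite S \<Longrightarrow> \<exists>e. \<forall>X\<in>S. F X e = h X"
    using ex_independent_functions by metis
  define f where "f \<alpha> = F (\<phi> \<alpha>)" for \<alpha>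
  define G where "G = (INF p\<in>\<kappa> - Id. principal {e. f (fst p) e < f (snd p) e})"
  have "G \<noteq> bot"
    unfolding G_def
  proof (rule INF_filter_not_bot)
    fix J assume J: "J \<subseteq> \<kappa> - Id" "finite J"
    let ?T = "Field J"
    have T: "finite ?T" "?T \<subseteq> Field \<kappa>"
      using J by (auto simp: finite_Field mono_Field intro: subsetD[OF mono_Field])
    define rank where "rank \<alpha> = card {\<gamma> \<in> ?T. (\<gamma>, \<alpha>) \<in> \<kappa> - Id}" for \<alpha>
    have trans: "trans \<kappa>" and antisym: "antisym \<kappa>"
      using \<kappa> by (auto simp: order_on_defs)
    have rank: "rank \<alpha> < rank \<beta>" if "(\<alpha>, \<beta>) \<in> J" for \<alpha> \<beta>
      unfolding rank_def
    proof (rule psubset_card_mono)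
      have ab: "(\<alpha>, \<beta>) \<in> \<kappa>" "\<alpha> \<noteq> \<beta>" "\<alpha> \<in> ?T" using that J by (auto intro: FieldI1)
      have "(\<gamma>, \<beta>) \<in> \<kappa> - Id" if "(\<gamma>, \<alpha>) \<in> \<kappa> - Id" for \<gamma>
        using that ab transD[OF trans, of \<gamma> \<alpha> \<beta>] antisymD[OF antisym, of \<alpha> \<beta>] by auto
      then show "{\<gamma> \<in> ?T. (\<gamma>, \<alpha>) \<in> \<kappa> - Id} \<subset> {\<gamma> \<in> ?T. (\<gamma>, \<beta>) \<in> \<kappa> - Id}"
        using ab by auto
    qed (use T in auto)
    obtain e where e: "\<And>\<alpha>. \<alpha> \<in> ?T \<Longrightarrow> f \<alpha> e = rank \<alpha>"
    proof -
      \<comment> \<open>Independence prescribes values by sets \<open>\<phi> \<alpha>\<close>, so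
        the rank is pulled back along the injection \<phi>.\<close>
      obtain e where "\<forall>X\<in>\<phi> ` ?T. F X e = rank (inv_into (Field \<kappa>) \<phi> X)"
        using F[of "\<phi> ` ?T" "\<lambda>X. rank (inv_into (Field \<kappa>) \<phi> X)"] T by blast
      then show ?thesis
        using T inv_into_f_f[OF \<phi>] by (intro that[of e]) (auto simp: f_def)
    qed
    have "e \<in> (\<Inter>p\<in>J. {e. f (fst p) e < f (snd p) e})"
      using rank e by (auto simp: FieldI1 FieldI2)
    then show "(INF p\<in>J. principal {e. f (fst p) e < f (snd p) e}) \<noteq> bot"
      by (subst INF_principal_finite[OF J(2)]) (auto simp: principal_eq_bot_iff)
  qed
  moreover have "\<forall>\<^sub>F e in G. f \<alpha> e < f \<beta> e" if "(\<alpha>, \<beta>) \<in> \<kappa>" "\<alpha> \<noteq> \<beta>" for \<alpha> \<beta>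
  proof -
    have "G \<le> principal {e. f (fst (\<alpha>, \<beta>)) e < f (snd (\<alpha>, \<beta>)) e}"
      unfolding G_def using that by (intro INF_lower) auto
    then show ?thesis by (simp add: le_principal)
  qed
  ultimately show ?thesis using that by blast
qed

section \<open>The chain of prime filters of closed sets\<close>

lemma decreasing_chain_of_prime_closed_filters:
  fixes \<kappa> :: "'k rel" and P :: "'x::{metric_space,perfect_space,second_countable_topology} set set"
  assumes \<kappa>: "Well_order \<kappa>" and card: "Field \<kappa> \<lesssim> (UNIV :: nat set set)" and ne: "Field \<kappa> \<noteq> {}"
    and P: "non_minimal prime_closed_filter P"
  shows "\<exists>Q. decreasing_chain_from \<kappa> prime_closed_filter P Q"
proof -
  have pP: "prime_closed_filter P" using P by (simp add: non_minimal_def)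
  obtain N where N: "N \<in> P" "interior N = {}" using non_minimal_imp_nowhere_dense[OF P] by blast
  obtain f :: "'k \<Rightarrow> nat \<times> (bool list \<times> nat) list \<Rightarrow> nat" and G where "G \<noteq> bot"
    and f: "\<And>\<alpha> \<beta>. (\<alpha>, \<beta>) \<in> \<kappa> \<Longrightarrow> \<alpha> \<noteq> \<beta> \<Longrightarrow> \<forall>\<^sub>F e in G. f \<alpha> e < f \<beta> e"
    using ex_increasing_modulo_filter[OF \<kappa> card] by metis
  obtain x lab U where x: "converges_fast N x" and U: "ultrafilter U" and lab: "filterlim lab G U"
    and U_P: "\<And>A. closed A \<Longrightarrow> A \<notin> P \<Longrightarrow> \<forall>\<^sub>F r in U. x r \<notin> A"
    using ex_ultrafilter_below[OF pP N \<open>G \<noteq> bot\<close>] by metis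
  have "\<forall>r. \<exists>C K. (\<forall>k. prime_closed_filter (C k)) \<and> decseq C \<and> (\<forall>A\<in>C 0. x r \<in> A) \<and>
      (\<forall>k. K k \<in> C k \<and> interior (K k) = {}) \<and> (\<forall>i j. i < j \<longrightarrow> K i \<notin> C j)"
    using ex_prime_closed_filter_sequence by (rule allI)
  then obtain C K where CK: "\<forall>r. (\<forall>k. prime_closed_filter (C r k)) \<and> decseq (C r) \<and>
      (\<forall>A\<in>C r 0. x r \<in> A) \<and> (\<forall>k. K r k \<in> C r k \<and> interior (K r k) = {}) \<and>
      (\<forall>i j. i < j \<longrightarrow> K r i \<notin> C r j)"
    unfolding choice_iff by (elim exE) (rule that)
  have C: "\<And>r k. prime_closed_filter (C r k)" "\<And>r. decseq (C r)"
      "\<And>r A. A \<in> C r 0 \<Longrightarrow> x r \<in> A"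
    and K: "\<And>r k. K r k \<in> C r k" "\<And>r k. interior (K r k) = {}"
      "\<And>r i j. i < j \<Longrightarrow> K r i \<notin> C r j"
    using CK by simp_all
  have Cx: "x r \<in> A" if "A \<in> C r k" for A r k
    by (rule C(3)[OF subsetD[OF decseqD[OF C(2) le0] that]])
  \<comment> \<open>\<open>lab\<close> tends to \<open>G\<close> along \<open>U\<close>, so
    inequalities that hold eventually in \<open>G\<close> become inequalities for
    \<open>U\<close>-almost all indices \<open>r\<close>.\<close>
  define h where "h \<alpha> r = f \<alpha> (lab r)" for \<alpha> r
  have h: "\<forall>\<^sub>F r in U. h \<alpha> r < h \<beta> r" if "(\<alpha>, \<beta>) \<in> \<kappa>" "\<alpha> \<noteq> \<beta>" for \<alpha> \<beta>
    unfolding h_def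
    using lab[unfolded filterlim_iff, rule_format, OF f[OF that]] .
  define Q where "Q \<alpha> = {A. closed A \<and> (\<forall>\<^sub>F r in U. A \<in> C r (h \<alpha> r))}" for \<alpha>
  have pQ: "prime_closed_filter (Q \<alpha>)" for \<alpha>
    unfolding Q_def by (intro prime_closed_filter_ultraproduct U C)
  have QP: "Q \<alpha> \<subseteq> P" for \<alpha>
  proof
    fix A assume A: "A \<in> Q \<alpha>"
    then have "\<forall>\<^sub>F r in U. x r \<in> A"
      by (auto simp: Q_def elim!: eventually_mono intro: Cx)
    then show "A \<in> P"
      using A U_P ultrafilter_eventually_not[OF U, of "\<lambda>r. x r \<in> A"] by (auto simp: Q_def)
  qed
  have less: "Q \<beta> \<subset> Q \<alpha>" if ab: "(\<alpha>, \<beta>) \<in> \<kappa>" "\<alpha> \<noteq> \<beta>" for \<alpha> \<beta>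
  proof
    show "Q \<beta> \<subseteq> Q \<alpha>"
    proof
      fix A assume A: "A \<in> Q \<beta>"
      then have "\<forall>\<^sub>F r in U. A \<in> C r (h \<beta> r)" by (simp add: Q_def)
      with h[OF ab] have "\<forall>\<^sub>F r in U. A \<in> C r (h \<alpha> r)"
        by eventually_elim (use decseqD[OF C(2)] in \<open>blast intro: less_imp_le\<close>)
      then show "A \<in> Q \<alpha>" using A by (simp add: Q_def)
    qed
    have N': "closed N" "N \<noteq> {}" using pP N prime_closed_filterD by blast+
    have "closed (K r k)" for r k using prime_closed_filterD(1)[OF C(1) K(1)] .
    \<comment> \<open>\<open>Z\<close> looks like \<open>K r (h \<alpha> r)\<close> to the filters
      at \<open>x r\<close>: it belongs to \<open>C r (h \<alpha> r)\<close> for all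
      \<open>r\<close>, but not to \<open>C r (h \<beta> r)\<close> when
      \<open>h \<alpha> r < h \<beta> r\<close>.\<close>
    then obtain Z where Z: "closed Z"
      "\<And>r F. prime_closed_filter F \<Longrightarrow> (\<And>A. A \<in> F \<Longrightarrow> x r \<in> A) \<Longrightarrow> Z \<in> F \<longleftrightarrow> K r (h \<alpha> r) \<in> F"
      using converges_fast_glue[OF N' N(2) x, of "\<lambda>r. K r (h \<alpha> r)"] K(2) by metis
    have ZK: "Z \<in> C r k \<longleftrightarrow> K r (h \<alpha> r) \<in> C r k" for r k
      using Z(2)[OF C(1) Cx] .
    have "Z \<in> Q \<alpha>" using Z(1) K(1) by (simp add: Q_def ZK)
    moreover have "Z \<notin> Q \<beta>"
    proof
      assume "Z \<in> Q \<beta>"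
      then have "\<forall>\<^sub>F r in U. K r (h \<alpha> r) \<in> C r (h \<beta> r)" by (simp add: Q_def ZK)
      with h[OF ab] have "\<forall>\<^sub>F r in U. False"
        by eventually_elim (use K(3) in blast)
      then show False using U by (simp add: ultrafilter_def trivial_limit_def)
    qed
    ultimately show "Q \<beta> \<noteq> Q \<alpha>" by blast
  qed
  define z where "z = wo_rel.minim \<kappa> (Field \<kappa>)"
  have wo: "wo_rel \<kappa>" using \<kappa> by (simp add: wo_rel_def)
  have z: "(z, \<alpha>) \<in> \<kappa>" if "\<alpha> \<in> Field \<kappa>" for \<alpha>
    using wo_rel.minim_least[OF wo] that by (simp add: z_def)
  have antisym: "antisym \<kappa>" using \<kappa> by (auto simp: order_on_defs)
  \<comment> \<open>\<open>Q z\<close> lies below \<open>P\<close> but need not equal it, so the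
    value at the least index is replaced by \<open>P\<close>. Later members stay strictly below
    \<open>P\<close>, being strictly below some \<open>Q \<alpha>\<close>.\<close>
  have "(Q(z := P)) \<beta> \<subset> (Q(z := P)) \<alpha>" if ab: "(\<alpha>, \<beta>) \<in> \<kappa>" "\<alpha> \<noteq> \<beta>" for \<alpha> \<beta>
  proof -
    have "\<beta> \<noteq> z"
      using z[of \<alpha>] ab antisymD[OF antisym, of \<alpha> \<beta>] by (auto intro: FieldI1)
    moreover have "Q \<beta> \<subset> P" using less[OF ab] QP[of \<alpha>] by blast
    ultimately show ?thesis using less[OF ab] by simp
  qed
  then show ?thesis
    using pP pQ unfolding decreasing_chain_from_def z_def[symmetric]
    by (intro exI[of _ "Q(z := P)"]) auto
qed

section \<open>Zero sets and prime z-filters\<close>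

lemma closed_zero_set: "f \<in> CR \<Longrightarrow> closed (zero_set f)"
  unfolding CR_def zero_set_def by (simp add: closed_vimage)

lemma ex_C0R_zero_set:
  assumes "closed S"
  obtains f :: "real \<Rightarrow> 'a::real_normed_field" where "f \<in> C0R" "zero_set f = S"
proof
  \<comment> \<open>Truncation at 1 bounds \<open>h\<close>, so that division by
    \<open>1 + \<bar>x\<bar>\<close> gives decay at infinity without new zeros. The empty set is
    treated apart because \<open>infdist x {}\<close> is 0.\<close>
  define h where "h x = (if S = {} then 1 else min 1 (infdist x S))" for x :: real
  let ?f = "\<lambda>x. of_real (h x / (1 + \<bar>x\<bar>)) :: 'a"
  have h: "0 \<le> h x" "h x \<le> 1" "h x = 0 \<longleftrightarrow> x \<in> S" for x
    using in_closed_iff_infdist_zero[OF assms] infdist_nonneg[of x S] by (auto simp: h_def min_def)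
  have "continuous_on UNIV h"
    unfolding h_def by (cases "S = {}") (auto intro!: continuous_intros)
  then have "continuous_on UNIV ?f"
    by (intro continuous_intros) (auto simp: add_nonneg_eq_0_iff)
  moreover have norm_f: "norm (?f x) = h x * inverse (1 + \<bar>x\<bar>)" for x
    unfolding norm_of_real using h(1)[of x] by (simp add: divide_inverse)
  have "(?f \<longlongrightarrow> 0) at_infinity"
  proof (rule Lim_null_comparison)
    show "\<forall>\<^sub>F x in at_infinity. norm (?f x) \<le> inverse (1 + \<bar>x\<bar>)"
      unfolding norm_f using h by (intro always_eventually allI mult_left_le_one_le) auto
    have "filterlim (\<lambda>x::real. 1 + norm x) at_top at_infinity"
      by (intro filterlim_tendsto_add_at_top[OF tendsto_const] filterlim_norm_at_top)
    then show "((\<lambda>x::real. inverse (1 + \<bar>x\<bar>)) \<longlongrightarrow> 0) at_infinity"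
      by (intro tendsto_inverse_0_at_top) simp
  qed
  ultimately show "?f \<in> C0R" by (simp add: C0R_def CR_def)
  have "?f x = 0 \<longleftrightarrow> x \<in> S" for x
    unfolding norm_eq_zero[of "?f x", symmetric] norm_f using h(3)
    by (simp add: add_nonneg_eq_0_iff)
  then show "zero_set ?f = S" unfolding zero_set_def by blast
qed

lemma C0R_subset_CR: "C0R \<subseteq> CR"
  by (auto simp: C0R_def)

lemma zero_sets_eq_closed: "zero_sets TYPE('a::real_normed_field) = Collect closed"
proof (intro equalityI subsetI)
  fix A :: "real set" assume "A \<in> Collect closed"
  then obtain f :: "real \<Rightarrow> 'a" where "f \<in> C0R" "zero_set f = A"
    using ex_C0R_zero_set by blast
  then show "A \<in> zero_sets TYPE('a)"
    using C0R_subset_CR unfolding zero_sets_def by blast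
next
  fix A assume "A \<in> zero_sets TYPE('a)"
  then show "A \<in> Collect closed"
    unfolding zero_sets_def by (auto intro: closed_zero_set)
qed

lemma prime_z_filter_iff: "prime_z_filter TYPE('a::real_normed_field) F \<longleftrightarrow> prime_closed_filter F"
proof
  assume F: "prime_z_filter TYPE('a) F"
  then have F': "F \<noteq> {}" "F \<subset> Collect closed" "\<forall>A\<in>F. \<forall>B\<in>F. A \<inter> B \<in> F"
    "\<forall>A\<in>F. \<forall>B\<in>Collect closed. A \<subseteq> B \<longrightarrow> B \<in> F"
    "\<forall>A \<in> Collect closed - F. \<forall>B \<in> Collect closed - F. A \<union> B \<notin> F"
    unfolding prime_z_filter_def z_filter_def zero_sets_eq_closed by blast+
  \<comment> \<open>The empty set would bring every closed set into \<open>F\<close>, against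
    properness.\<close>
  have "{} \<notin> F" using F'(2,4) by blast
  moreover have "UNIV \<in> F" using F'(1,4) by auto
  ultimately show "prime_closed_filter F"
    using F'(2-5) unfolding prime_closed_filter_def by blast
next
  assume F: "prime_closed_filter F"
  then have "F \<noteq> {}" "F \<subset> Collect closed"
    unfolding prime_closed_filter_def by blast+
  then show "prime_z_filter TYPE('a) F"
    using F unfolding prime_z_filter_def z_filter_def zero_sets_eq_closed prime_closed_filter_def
    by blast
qed

section \<open>The correspondence with prime z-ideals\<close>

definition ideal_of_filter :: "real set set \<Rightarrow> (real \<Rightarrow> 'a::real_normed_field) set" where
  "ideal_of_filter F = {f \<in> C0R. zero_set f \<in> F}"

lemma C0R_zero [simp]: "(\<lambda>x. 0) \<in> C0R"
  by (simp add: C0R_def CR_def)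

lemma C0R_add: "f \<in> C0R \<Longrightarrow> g \<in> C0R \<Longrightarrow> (\<lambda>x. f x + g x) \<in> C0R"
  by (simp add: C0R_def CR_def continuous_on_add tendsto_add_zero)

lemma C0R_mult: "f \<in> C0R \<Longrightarrow> g \<in> C0R \<Longrightarrow> (\<lambda>x. f x * g x) \<in> C0R"
  by (simp add: C0R_def CR_def continuous_on_mult tendsto_mult_zero)

lemma C0R_cmult: "f \<in> C0R \<Longrightarrow> (\<lambda>x. c * f x) \<in> C0R"
  by (simp add: C0R_def CR_def continuous_on_mult tendsto_mult_right_zero)

text \<open>Used for intersections of zero sets: the sum of the absolute values of two functions
  vanishes exactly at their common zeros, which their sum or, for complex scalars, the sum of their
  squares need not do.\<close>

lemma C0R_norm:
  fixes f :: "real \<Rightarrow> 'a::real_normed_field"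
  assumes "f \<in> C0R"
  shows "(\<lambda>x. of_real (norm (f x)) :: 'a) \<in> C0R"
proof -
  have f: "continuous_on UNIV f" "(f \<longlongrightarrow> 0) at_infinity"
    using assms by (simp_all add: C0R_def CR_def)
  have "continuous_on UNIV (\<lambda>x. of_real (norm (f x)) :: 'a)"
    by (intro continuous_on_of_real continuous_on_norm f)
  moreover have "((\<lambda>x. of_real (norm (f x)) :: 'a) \<longlongrightarrow> of_real 0) at_infinity"
    by (intro tendsto_of_real tendsto_norm_zero f)
  ultimately show ?thesis by (simp add: C0R_def CR_def)
qed

text \<open>\<open>C0R\<close> realizes every closed set as a zero set, so no member of
  \<open>F\<close> is lost. This makes \<open>ideal_of_filter\<close> injective on families of
  closed sets and keeps the chain strict.\<close>

lemma zero_set_image_ideal_of_filter: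
  assumes "F \<subseteq> Collect closed"
  shows "zero_set ` (ideal_of_filter F :: (real \<Rightarrow> 'a::real_normed_field) set) = F"
proof (intro equalityI subsetI)
  fix A assume "A \<in> F"
  then show "A \<in> zero_set ` (ideal_of_filter F :: (real \<Rightarrow> 'a) set)"
  proof -
    obtain f :: "real \<Rightarrow> 'a" where "f \<in> C0R" "zero_set f = A"
      using assms \<open>A \<in> F\<close> ex_C0R_zero_set by blast
    then show ?thesis using \<open>A \<in> F\<close> by (auto simp: ideal_of_filter_def)
  qed
qed (auto simp: ideal_of_filter_def)

lemma prime_z_ideal_of_filter:
  assumes F: "prime_closed_filter F"
  shows "prime_z_ideal (ideal_of_filter F :: (real \<Rightarrow> 'a::real_normed_field) set)"
proof -
  let ?I = "ideal_of_filter F :: (real \<Rightarrow> 'a) set"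
  have cl: "closed (zero_set f)" if "f \<in> C0R" for f :: "real \<Rightarrow> 'a"
    using that C0R_subset_CR closed_zero_set by blast
  have up: "g \<in> ?I" if "f \<in> ?I" "g \<in> C0R" "zero_set f \<subseteq> zero_set g" for f g
    using that prime_closed_filterD(5)[OF F] cl by (auto simp: ideal_of_filter_def)
  have "(\<lambda>x. 0) \<in> ?I"
    using prime_closed_filterD(2)[OF F] by (simp add: ideal_of_filter_def zero_set_def)
  moreover have "(\<lambda>x. f x + g x) \<in> ?I" if "f \<in> ?I" "g \<in> ?I" for f g
  proof -
    have fg: "(\<lambda>x. f x + g x) \<in> C0R" using that by (auto simp: ideal_of_filter_def intro: C0R_add)
    have "zero_set f \<inter> zero_set g \<in> F"
      using that prime_closed_filterD(4)[OF F] by (auto simp: ideal_of_filter_def)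
    moreover have "zero_set f \<inter> zero_set g \<subseteq> zero_set (\<lambda>x. f x + g x)"
      by (auto simp: zero_set_def)
    ultimately show ?thesis
      using prime_closed_filterD(5)[OF F] cl[OF fg] fg by (auto simp: ideal_of_filter_def)
  qed
  moreover have "(\<lambda>x. c * f x) \<in> ?I" if "f \<in> ?I" for c f
    using that by (intro up[OF that] C0R_cmult) (auto simp: zero_set_def ideal_of_filter_def)
  moreover have "(\<lambda>x. h x * f x) \<in> ?I" if "f \<in> ?I" "h \<in> C0R" for h f
    using that by (intro up[OF that(1)] C0R_mult) (auto simp: zero_set_def ideal_of_filter_def)
  ultimately have ideal: "C0R_ideal ?I"
    unfolding C0R_ideal_def by (auto simp: ideal_of_filter_def)
  \<comment> \<open>A function of \<open>C0R\<close> without zeros witnesses that the ideal is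
    proper.\<close>
  obtain u :: "real \<Rightarrow> 'a" where "u \<in> C0R" "zero_set u = {}"
    using ex_C0R_zero_set[OF closed_empty] by blast
  then have "u \<in> C0R - ?I"
    using prime_closed_filterD(3)[OF F] by (simp add: ideal_of_filter_def)
  moreover have "f \<in> ?I \<or> g \<in> ?I" if "f \<in> C0R" "g \<in> C0R" "(\<lambda>x. f x * g x) \<in> ?I" for f g
  proof -
    have "zero_set (\<lambda>x. f x * g x) = zero_set f \<union> zero_set g"
      by (auto simp: zero_set_def)
    then show ?thesis
      using that cl prime_closed_filterD(6)[OF F] by (auto simp: ideal_of_filter_def)
  qed
  ultimately show ?thesis
    using ideal up unfolding prime_z_ideal_def C0R_prime_ideal_def C0R_z_ideal_def by blast
qed

text \<open>Membership in a z-ideal depends only on the zero set, so the ideal can be recovered from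
  its zero sets. Products account for unions, sums of absolute values for intersections.\<close>

lemma
  fixes I :: "(real \<Rightarrow> 'a::real_normed_field) set"
  assumes I: "prime_z_ideal I"
  shows ideal_of_filter_zero_set_image: "ideal_of_filter (zero_set ` I) = I"
    and prime_closed_filter_zero_set_image: "prime_closed_filter (zero_set ` I)"
proof -
  have sub: "I \<subseteq> C0R" and zero: "(\<lambda>x. 0) \<in> I"
    and add: "\<And>f g. f \<in> I \<Longrightarrow> g \<in> I \<Longrightarrow> (\<lambda>x. f x + g x) \<in> I"
    and z: "\<And>f g. g \<in> C0R \<Longrightarrow> f \<in> I \<Longrightarrow> zero_set f \<subseteq> zero_set g \<Longrightarrow> g \<in> I"
    and proper: "I \<noteq> C0R"
    and prime: "\<And>f g. f \<in> C0R \<Longrightarrow> g \<in> C0R \<Longrightarrow> (\<lambda>x. f x * g x) \<in> I \<Longrightarrow> f \<in> I \<or> g \<in> I"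
    using I unfolding prime_z_ideal_def C0R_prime_ideal_def C0R_z_ideal_def C0R_ideal_def by blast+
  have mem: "f \<in> I \<longleftrightarrow> zero_set f \<in> zero_set ` I" if "f \<in> C0R" for f
    using z[OF that] by auto
  then show "ideal_of_filter (zero_set ` I) = I"
    using sub by (auto simp: ideal_of_filter_def)
  show "prime_closed_filter (zero_set ` I)"
    unfolding prime_closed_filter_def
  proof (intro conjI ballI allI impI)
    show "zero_set ` I \<subseteq> Collect closed"
      using sub C0R_subset_CR closed_zero_set by auto
    show "UNIV \<in> zero_set ` I"
      using zero by (rule rev_image_eqI) (simp add: zero_set_def)
    \<comment> \<open>A member without zeros would force all of \<open>C0R\<close> into
      \<open>I\<close>.\<close>
    show "{} \<notin> zero_set ` I"
      using z sub proper by blast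
  next
    fix A B assume "A \<in> zero_set ` I" "B \<in> zero_set ` I"
    then obtain f g where f: "f \<in> I" "A = zero_set f" and g: "g \<in> I" "B = zero_set g" by auto
    have norm: "(\<lambda>x. of_real (norm (u x)) :: 'a) \<in> I" if "u \<in> I" for u :: "real \<Rightarrow> 'a"
    proof (rule z)
      show "(\<lambda>x. of_real (norm (u x)) :: 'a) \<in> C0R" using that sub by (intro C0R_norm) blast
    qed (use that in \<open>auto simp: zero_set_def\<close>)
    have "(\<lambda>x. of_real (norm (f x)) + of_real (norm (g x))) \<in> I"
      using add[OF norm[OF f(1)] norm[OF g(1)]] .
    moreover have "A \<inter> B = zero_set (\<lambda>x. of_real (norm (f x)) + of_real (norm (g x)) :: 'a)"
      using f g by (auto simp: zero_set_def add_nonneg_eq_0_iff simp flip: of_real_add)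
    ultimately show "A \<inter> B \<in> zero_set ` I" by blast
  next
    fix A B :: "real set" assume A: "A \<in> zero_set ` I" "closed B" "A \<subseteq> B"
    obtain g :: "real \<Rightarrow> 'a" where "g \<in> C0R" "zero_set g = B"
      using ex_C0R_zero_set[OF \<open>closed B\<close>] by blast
    then show "B \<in> zero_set ` I" using A z by blast
  next
    fix A B :: "real set" assume AB: "closed A" "closed B" "A \<union> B \<in> zero_set ` I"
    obtain f g :: "real \<Rightarrow> 'a" where fg: "f \<in> C0R" "zero_set f = A" "g \<in> C0R" "zero_set g = B"
      using ex_C0R_zero_set[OF \<open>closed A\<close>] ex_C0R_zero_set[OF \<open>closed B\<close>] by metis
    then have "zero_set (\<lambda>x. f x * g x) = A \<union> B" by (auto simp: zero_set_def)
    then have "(\<lambda>x. f x * g x) \<in> I" using AB fg mem[OF C0R_mult] by auto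
    then show "A \<in> zero_set ` I \<or> B \<in> zero_set ` I" using prime fg by blast
  qed
qed

lemma decreasing_chain_of_prime_z_filters:
  fixes \<kappa> :: "'k rel"
  assumes \<kappa>: "Well_order \<kappa>" "Field \<kappa> \<lesssim> (UNIV :: nat set set)" "Field \<kappa> \<noteq> {}"
    and P: "non_minimal (prime_z_filter TYPE('a::real_normed_field)) P"
  shows "\<exists>Q. decreasing_chain_from \<kappa> (prime_z_filter TYPE('a)) P Q"
proof -
  have "prime_z_filter TYPE('a) = prime_closed_filter"
    by (intro ext prime_z_filter_iff)
  then show ?thesis
    using decreasing_chain_of_prime_closed_filters[OF \<kappa>] P by simp
qed

lemma decreasing_chain_of_prime_z_ideals:
  fixes \<kappa> :: "'k rel" and P :: "(real \<Rightarrow> 'a::real_normed_field) set"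
  assumes \<kappa>: "Well_order \<kappa>" "Field \<kappa> \<lesssim> (UNIV :: nat set set)" "Field \<kappa> \<noteq> {}"
    and P: "non_minimal prime_z_ideal P"
  shows "\<exists>Q. decreasing_chain_from \<kappa> prime_z_ideal P Q"
proof -
  obtain P' where P': "prime_z_ideal P" "prime_z_ideal P'" "P' \<subset> P"
    using P unfolding non_minimal_def by blast
  have "zero_set ` P' \<subseteq> zero_set ` P" using P' by blast
  \<comment> \<open>The inclusion stays strict because both ideals are recovered from their zero
    sets.\<close>
  moreover have "zero_set ` P' \<noteq> zero_set ` P"
    using P' ideal_of_filter_zero_set_image by (metis psubset_eq)
  ultimately have "non_minimal prime_closed_filter (zero_set ` P)"
    unfolding non_minimal_def using P' prime_closed_filter_zero_set_image by blast
  then obtain Q where Q: "decreasing_chain_from \<kappa> prime_closed_filter (zero_set ` P) Q"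
    using decreasing_chain_of_prime_closed_filters[OF \<kappa>] by blast
  have pQ: "prime_closed_filter (Q \<alpha>)" if "\<alpha> \<in> Field \<kappa>" for \<alpha>
    using Q that by (simp add: decreasing_chain_from_def)
  let ?I = "\<lambda>\<alpha>. ideal_of_filter (Q \<alpha>) :: (real \<Rightarrow> 'a) set"
  have "?I \<beta> \<subset> ?I \<alpha>" if ab: "(\<alpha>, \<beta>) \<in> \<kappa>" "\<alpha> \<noteq> \<beta>" for \<alpha> \<beta>
  proof
    have "Q \<beta> \<subset> Q \<alpha>" using Q ab by (simp add: decreasing_chain_from_def)
    then show "?I \<beta> \<subseteq> ?I \<alpha>" by (auto simp: ideal_of_filter_def)
    have "Q \<alpha> \<subseteq> Collect closed" "Q \<beta> \<subseteq> Collect closed"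
      using pQ prime_closed_filterD(1) ab by (blast intro: FieldI1 FieldI2)+
    then show "?I \<beta> \<noteq> ?I \<alpha>"
      using \<open>Q \<beta> \<subset> Q \<alpha>\<close> zero_set_image_ideal_of_filter by (metis psubset_eq)
  qed
  moreover have "ideal_of_filter (Q (wo_rel.minim \<kappa> (Field \<kappa>))) = P"
    using Q ideal_of_filter_zero_set_image[OF P'(1)] by (simp add: decreasing_chain_from_def)
  moreover have "prime_z_ideal (?I \<alpha>)" if "\<alpha> \<in> Field \<kappa>" for \<alpha>
    by (rule prime_z_ideal_of_filter[OF pQ[OF that]])
  ultimately have "decreasing_chain_from \<kappa> prime_z_ideal P ?I"
    by (simp add: decreasing_chain_from_def)
  then show ?thesis by blast
qed

theorem corollary4p6:
  fixes \<kappa> :: "'k rel"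
  assumes "Well_order \<kappa>"
    and "Field \<kappa> \<approx> (UNIV :: nat set set)"
  shows
    "((\<forall>P. non_minimal (prime_z_filter TYPE(real)) P \<longrightarrow>
          (\<exists>Q. decreasing_chain_from \<kappa> (prime_z_filter TYPE(real)) P Q)) \<and>
      (\<forall>P :: (real \<Rightarrow> real) set. non_minimal prime_z_ideal P \<longrightarrow>
          (\<exists>Q. decreasing_chain_from \<kappa> prime_z_ideal P Q))) \<and>
     ((\<forall>P. non_minimal (prime_z_filter TYPE(complex)) P \<longrightarrow>
          (\<exists>Q. decreasing_chain_from \<kappa> (prime_z_filter TYPE(complex)) P Q)) \<and>
      (\<forall>P :: (real \<Rightarrow> complex) set. non_minimal prime_z_ideal P \<longrightarrow>
          (\<exists>Q. decreasing_chain_from \<kappa> prime_z_ideal P Q)))"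
proof -
  have "Field \<kappa> \<lesssim> (UNIV :: nat set set)" "Field \<kappa> \<noteq> {}"
    using assms(2) by (auto simp: eqpoll_imp_lepoll eqpoll_def bij_betw_def)
  note \<kappa> = assms(1) this
  show ?thesis
    by (intro conjI allI impI decreasing_chain_of_prime_z_filters[OF \<kappa>]
        decreasing_chain_of_prime_z_ideals[OF \<kappa>])
qed

end
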